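(* For all positive integers $d$ and $k$ and every integer $r \in [0, d-1]$, there exists a family $\mathcal{P}_{d,k,r}$ of $d$-dimensional 0-1 matrices such that $\operatorname{sat}(n, \mathcal{P}_{d,k,r}, d) = k n^r$ for all $n$ sufficiently large.
   Context: A $d$-dimensional 0-1 matrix $A$ contains a $d$-dimensional 0-1 matrix $P$ if $A$ has a submatrix (obtained by restricting each of the $d$ coordinates to a subset of its range) of the same dimensions as $P$ that can be turned into $P$ by changing any number of $1$-entries to $0$-entries; otherwise $A$ avoids $P$. A matrix $A$ is $\mathcal{P}$-saturated if $A$ avoids every element of $\mathcal{P}$ and changing any $0$-entry of $A$ to a $1$-entry produces a matrix that contains some element of $\mathcal{P}$. $\operatorname{sat}(n,\mathcal{P},d)$ is the minimum possible number of $1$-entries in a $\mathcal{P}$-saturated $d$-dimensional $n\times\dots\times n$ 0-1 matrix. *)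

theory Defs
  imports Complex_Main
begin

text \<open>
  A multidimensional 0-1 matrix is given by the list of its side lengths (so the dimension is the
  length of that list) and the set of the positions of its 1-entries; positions are lists of
  0-based coordinates.
\<close>

datatype matrix01 = Matrix01 (dims: "nat list") (ones: "nat list set")

definition positions :: "nat list \<Rightarrow> nat list set" where
  "positions ns = {is. length is = length ns \<and> (\<forall>j<length ns. is ! j < ns ! j)}"

definition is_matrix01 :: "nat \<Rightarrow> matrix01 \<Rightarrow> bool" where
  "is_matrix01 d A \<longleftrightarrow>
     length (dims A) = d \<and> (\<forall>j<d. 0 < dims A ! j) \<and> ones A \<subseteq> positions (dims A)"

text \<open>
  Restriction of the \<open>j\<close>-th coordinate to the finite set \<open>Ss ! j\<close>, whose elements are renumbered
  \<open>0, 1, \<dots>\<close> in increasing order.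
\<close>

definition submatrix :: "matrix01 \<Rightarrow> nat set list \<Rightarrow> matrix01" where
  "submatrix A Ss = Matrix01 (map card Ss)
     {is \<in> positions (map card Ss). map2 (\<lambda>S i. sorted_list_of_set S ! i) Ss is \<in> ones A}"

definition contains :: "matrix01 \<Rightarrow> matrix01 \<Rightarrow> bool" where
  "contains A P \<longleftrightarrow>
     (\<exists>Ss. length Ss = length (dims A) \<and> (\<forall>j<length (dims A). Ss ! j \<subseteq> {..<dims A ! j}) \<and>
           dims (submatrix A Ss) = dims P \<and> ones P \<subseteq> ones (submatrix A Ss))"

abbreviation avoids :: "matrix01 \<Rightarrow> matrix01 \<Rightarrow> bool" where
  "avoids A P \<equiv> \<not> contains A P"

definition set_one :: "nat list \<Rightarrow> matrix01 \<Rightarrow> matrix01" where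
  "set_one p A = Matrix01 (dims A) (insert p (ones A))"

definition saturated :: "matrix01 set \<Rightarrow> matrix01 \<Rightarrow> bool" where
  "saturated \<P> A \<longleftrightarrow>
     (\<forall>P\<in>\<P>. avoids A P) \<and>
     (\<forall>p \<in> positions (dims A) - ones A. \<exists>P\<in>\<P>. contains (set_one p A) P)"

text \<open>
  The infimum over \<^typ>\<open>nat\<close> is the minimum if some saturated matrix exists and \<open>0\<close> otherwise;
  hence a positive value of \<open>sat n \<P> d\<close> is always attained by a saturated matrix.
\<close>

definition sat :: "nat \<Rightarrow> matrix01 set \<Rightarrow> nat \<Rightarrow> nat" where
  "sat n \<P> d = Inf {card (ones A) |A. is_matrix01 d A \<and> dims A = replicate d n \<and> saturated \<P> A}"

end

theory Submission
  imports Defs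
begin

text \<open>
  A class of matrices closed under submatrices and under deleting 1-entries is defined by the
  family of all matrices outside it, and its saturated members are its maximal ones. Take the class
  of matrices in which every fibre of the projection to the first \<open>r\<close> coordinates has at most \<open>k\<close>
  1-entries. As \<open>r < d\<close>, a fibre has at least \<open>n \<ge> k\<close> positions, so in a maximal matrix each of the
  \<open>n ^ r\<close> fibres has exactly \<open>k\<close> 1-entries.
\<close>

definition fibre :: "nat \<Rightarrow> matrix01 \<Rightarrow> nat list \<Rightarrow> nat list set" where
  "fibre r A a = {p \<in> ones A. take r p = a}"

text \<open>Arbitrary side lengths are allowed, so a matrix outside the class is itself a member of
  the family. Members have finitely many 1-entries, so \<open>card\<close> never takes its default
  value 0 on an infinite fibre.\<close>

definition heavy_fibre :: "nat \<Rightarrow> nat \<Rightarrow> nat \<Rightarrow> matrix01 set" where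
  "heavy_fibre d k r = {P. is_matrix01 d P \<and> (\<exists>a. k < card (fibre r P a))}"

lemma positions_replicate: "positions (replicate m n) = {xs. set xs \<subseteq> {..<n} \<and> length xs = m}"
  by (auto simp: positions_def in_set_conv_nth subset_iff)

lemma finite_positions_replicate: "finite (positions (replicate m n))"
  by (simp add: positions_replicate finite_lists_length_eq)

lemma card_positions_replicate: "card (positions (replicate m n)) = n ^ m"
  by (simp add: positions_replicate card_lists_length_eq)

lemma take_positions_replicate:
  assumes "p \<in> positions (replicate d n)" "r \<le> d"
  shows "take r p \<in> positions (replicate r n)"
  using assms by (auto simp: positions_replicate dest: in_set_takeD)

lemma card_positions_fibre:
  assumes "r \<le> d" "a \<in> positions (replicate r n)"
  shows "card {p \<in> positions (replicate d n). take r p = a} = n ^ (d - r)"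
proof -
  have "{p \<in> positions (replicate d n). take r p = a} = (@) a ` positions (replicate (d - r) n)"
    (is "?L = ?R")
  proof
    show "?L \<subseteq> ?R"
    proof
      fix p assume p: "p \<in> ?L"
      then have "p = a @ drop r p" by auto
      moreover have "drop r p \<in> positions (replicate (d - r) n)"
        using p by (auto simp: positions_replicate dest: in_set_dropD)
      ultimately show "p \<in> ?R" by blast
    qed
    show "?R \<subseteq> ?L" using assms by (auto simp: positions_replicate)
  qed
  then show ?thesis by (simp add: card_image card_positions_replicate inj_on_def)
qed

lemma le_card_positions_fibre:
  assumes "r < d" "k \<le> n" "a \<in> positions (replicate r n)"
  shows "k \<le> card {p \<in> positions (replicate d n). take r p = a}"
proof -
  \<comment> \<open>Since \<open>r < d\<close>, the exponent is at least 1.\<close>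
  have "n \<le> n ^ (d - r)" using \<open>r < d\<close> by (cases "n = 0") (simp_all add: self_le_power)
  with assms show ?thesis by (simp add: card_positions_fibre)
qed

lemma contains_refl:
  assumes "is_matrix01 d A"
  shows "contains A A"
proof -
  \<comment> \<open>With full coordinate ranges the renumbering is the identity.\<close>
  let ?Ss = "map lessThan (dims A)"
  have id: "map2 (\<lambda>S i. sorted_list_of_set S ! i) ?Ss p = p" if "p \<in> positions (dims A)" for p
    using that by (auto simp: positions_def list_eq_iff_nth_eq lessThan_atLeast0)
  have "map card ?Ss = dims A" by (simp add: comp_def)
  with assms show ?thesis unfolding contains_def submatrix_def is_matrix01_def
    by (intro exI[of _ ?Ss]) (auto simp: id)
qed

text \<open>This makes the class closed under containment. The renumbering of a submatrix is
  injective and acts on each coordinate separately, so it respects prefixes of length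
  \<open>r\<close> and sends a whole fibre of \<open>P\<close> into a single fibre of
  \<open>A\<close>.\<close>

lemma contains_card_fibre_le:
  assumes "contains A P" "finite (ones A)"
  shows "\<exists>b. card (fibre r P a) \<le> card (fibre r A b)"
proof -
  from assms obtain Ss where
    len: "length Ss = length (dims A)" and
    sub: "\<forall>j<length (dims A). Ss ! j \<subseteq> {..<dims A ! j}" and
    ones: "ones P \<subseteq> ones (submatrix A Ss)"
    unfolding contains_def by blast
  define f where "f = map2 (\<lambda>S i. sorted_list_of_set S ! i) Ss"
  \<comment> \<open>Each coordinate is looked up in a list without repetitions, at an index below
    its length.\<close>
  have inj: "inj_on f (positions (map card Ss))"
  proof (rule inj_onI)
    fix p q assume pq: "p \<in> positions (map card Ss)" "q \<in> positions (map card Ss)" "f p = f q"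
    then have l: "length p = length Ss" "length q = length Ss" by (auto simp: positions_def)
    show "p = q"
    proof (rule nth_equalityI)
      fix j assume "j < length p"
      with l have j: "j < length Ss" by simp
      have "f p ! j = f q ! j" using pq by simp
      then have "sorted_list_of_set (Ss ! j) ! (p ! j) = sorted_list_of_set (Ss ! j) ! (q ! j)"
        using j l by (simp add: f_def)
      moreover have "p ! j < card (Ss ! j)" "q ! j < card (Ss ! j)"
        using pq j by (auto simp: positions_def)
      ultimately show "p ! j = q ! j" by (simp add: nth_eq_iff_index_eq)
    qed (use l in simp)
  qed
  \<comment> \<open>The prefix \<open>a\<close>, renumbered by the first \<open>r\<close> coordinate
    sets.\<close>
  let ?b = "map2 (\<lambda>S i. sorted_list_of_set S ! i) (take r Ss) a"
  have "fibre r P a \<subseteq> positions (map card Ss)"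
    using ones by (auto simp: fibre_def submatrix_def)
  then have "inj_on f (fibre r P a)" using inj inj_on_subset by blast
  moreover have "f ` fibre r P a \<subseteq> fibre r A ?b"
    using ones by (auto simp: fibre_def submatrix_def f_def take_map take_zip)
  moreover have "finite (fibre r A ?b)" using assms by (simp add: fibre_def)
  ultimately have "card (fibre r P a) \<le> card (fibre r A ?b)" by (rule card_inj_on_le)
  then show ?thesis ..
qed

text \<open>If some fibre is too heavy, then \<open>A\<close> lies in the family and contains
  itself; conversely, a heavy fibre of a contained matrix forces one in \<open>A\<close>.\<close>

lemma avoids_heavy_fibre_iff:
  assumes "is_matrix01 d A" "finite (ones A)"
  shows "(\<forall>P\<in>heavy_fibre d k r. avoids A P) \<longleftrightarrow> (\<forall>a. card (fibre r A a) \<le> k)"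
proof
  assume "\<forall>P\<in>heavy_fibre d k r. avoids A P"
  then show "\<forall>a. card (fibre r A a) \<le> k"
    using assms contains_refl by (fastforce simp: heavy_fibre_def not_less)
next
  assume le: "\<forall>a. card (fibre r A a) \<le> k"
  show "\<forall>P\<in>heavy_fibre d k r. avoids A P"
  proof (intro ballI notI)
    fix P assume P: "P \<in> heavy_fibre d k r" "contains A P"
    from P(1) obtain a where "k < card (fibre r P a)" by (auto simp: heavy_fibre_def)
    moreover obtain b where "card (fibre r P a) \<le> card (fibre r A b)"
      using contains_card_fibre_le[OF P(2) assms(2)] by blast
    ultimately show False using le by (meson leD order_trans)
  qed
qed

text \<open>A new 1-entry enlarges only the fibre through its position, so maximality can be tested
  on each fibre separately.\<close>

lemma saturated_heavy_fibre_iff: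
  assumes A: "is_matrix01 d A" "dims A = replicate d n" and "r < d" "k \<le> n"
  shows "saturated (heavy_fibre d k r) A \<longleftrightarrow>
    (\<forall>a\<in>positions (replicate r n). card (fibre r A a) = k)" (is "_ \<longleftrightarrow> ?R")
proof -
  have sub: "ones A \<subseteq> positions (replicate d n)" using A by (simp add: is_matrix01_def)
  then have fin: "finite (ones A)" using finite_positions_replicate finite_subset by blast
  then have finf: "finite (fibre r A a)" for a by (simp add: fibre_def)
  have outside: "fibre r A a = {}" if "a \<notin> positions (replicate r n)" for a
    using that sub \<open>r < d\<close> take_positions_replicate[of _ d n r] by (fastforce simp: fibre_def)
  have fibre_set_one: "fibre r (set_one p A) a =
      (if take r p = a then insert p (fibre r A a) else fibre r A a)" for p a
    by (auto simp: fibre_def set_one_def)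
  have step: "(\<exists>P\<in>heavy_fibre d k r. contains (set_one p A) P) \<longleftrightarrow>
      \<not> (\<forall>a. card (fibre r (set_one p A) a) \<le> k)" if "p \<in> positions (dims A) - ones A" for p
  proof -
    have "is_matrix01 d (set_one p A)" "finite (ones (set_one p A))"
      using that A fin by (auto simp: is_matrix01_def set_one_def)
    from avoids_heavy_fibre_iff[OF this] show ?thesis by blast
  qed
  have sat_iff: "saturated (heavy_fibre d k r) A \<longleftrightarrow> (\<forall>a. card (fibre r A a) \<le> k) \<and>
      (\<forall>p \<in> positions (dims A) - ones A. \<not> (\<forall>a. card (fibre r (set_one p A) a) \<le> k))"
    unfolding saturated_def using avoids_heavy_fibre_iff[OF A(1) fin] step by simp
  show ?thesis
  proof
    assume "saturated (heavy_fibre d k r) A"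
    then have le: "\<And>a. card (fibre r A a) \<le> k"
      and ext: "\<And>p. p \<in> positions (dims A) - ones A \<Longrightarrow> \<exists>a. k < card (fibre r (set_one p A) a)"
      using sat_iff by (auto simp: not_le)
    show ?R
    proof (intro ballI antisym le)
      fix a assume a: "a \<in> positions (replicate r n)"
      let ?F = "{p \<in> positions (replicate d n). take r p = a}"
      have kF: "k \<le> card ?F" using le_card_positions_fibre[OF assms(3,4) a] .
      show "k \<le> card (fibre r A a)"
      proof (rule ccontr)
        assume lt: "\<not> k \<le> card (fibre r A a)"
        \<comment> \<open>The fibre has at least \<open>k\<close> positions but fewer than
          \<open>k\<close> 1-entries, so some position \<open>p\<close> in it holds a 0.\<close>
        then have "\<not> ?F \<subseteq> fibre r A a" using kF card_mono[OF finf[of a], of ?F] by linarith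
        then obtain p where p: "p \<in> positions (replicate d n)" "take r p = a" "p \<notin> ones A"
          by (auto simp: fibre_def)
        then obtain b where b: "k < card (fibre r (set_one p A) b)" using ext A by auto
        \<comment> \<open>For \<open>b = a\<close> the count rises by one from below
          \<open>k\<close>; every other fibre is unchanged.\<close>
        have "card (fibre r (set_one p A) b) \<le> k"
          using lt le[of b] p finf by (auto simp: fibre_set_one card_insert_if)
        with b show False by simp
      qed
    qed
  next
    assume R: ?R
    have "card (fibre r A a) \<le> k" for a
      using R outside[of a] by (cases "a \<in> positions (replicate r n)") auto
    \<comment> \<open>The fibre through \<open>p\<close> is already full, so it grows to
      \<open>k + 1\<close>.\<close>
    moreover have "\<not> card (fibre r (set_one p A) (take r p)) \<le> k"
      if p: "p \<in> positions (dims A) - ones A" for p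
    proof -
      have "take r p \<in> positions (replicate r n)"
        using p A \<open>r < d\<close> by (auto intro: take_positions_replicate)
      moreover have "p \<notin> fibre r A (take r p)" using p by (simp add: fibre_def)
      ultimately show ?thesis using R finf by (simp add: fibre_set_one)
    qed
    ultimately show "saturated (heavy_fibre d k r) A" using sat_iff by blast
  qed
qed

lemma card_ones_eq_sum_fibre:
  assumes "is_matrix01 d A" "dims A = replicate d n" "r \<le> d"
  shows "card (ones A) = (\<Sum>a\<in>positions (replicate r n). card (fibre r A a))"
proof -
  have sub: "ones A \<subseteq> positions (replicate d n)" using assms by (simp add: is_matrix01_def)
  then have fin: "finite (ones A)" using finite_positions_replicate finite_subset by blast
  have "ones A = (\<Union>a\<in>positions (replicate r n). fibre r A a)"
    using sub assms(3) take_positions_replicate[of _ d n r] by (auto simp: fibre_def)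
  moreover have "card (\<Union>a\<in>positions (replicate r n). fibre r A a) =
      (\<Sum>a\<in>positions (replicate r n). card (fibre r A a))"
    using fin by (intro card_UN_disjoint) (auto simp: finite_positions_replicate fibre_def)
  ultimately show ?thesis by simp
qed

text \<open>Fibres are disjoint, so \<open>k\<close> positions can be chosen in each independently.
  Existence matters because \<open>sat\<close> would be 0 if no saturated matrix existed.\<close>

lemma exists_constant_fibres:
  assumes "r < d" "k \<le> n" "0 < n"
  shows "\<exists>A. is_matrix01 d A \<and> dims A = replicate d n \<and>
    (\<forall>a\<in>positions (replicate r n). card (fibre r A a) = k)"
proof -
  have "\<exists>S \<subseteq> {p \<in> positions (replicate d n). take r p = a}. card S = k"
    if "a \<in> positions (replicate r n)" for a
    using le_card_positions_fibre[OF assms(1,2) that] by (meson obtain_subset_with_card_n)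
  then obtain S where S: "\<And>a. a \<in> positions (replicate r n) \<Longrightarrow>
      S a \<subseteq> {p \<in> positions (replicate d n). take r p = a} \<and> card (S a) = k"
    by metis
  define A where "A = Matrix01 (replicate d n) (\<Union>a\<in>positions (replicate r n). S a)"
  have "fibre r A a = S a" if "a \<in> positions (replicate r n)" for a
    using S that by (fastforce simp: fibre_def A_def)
  moreover have "is_matrix01 d A" using S assms by (fastforce simp: is_matrix01_def A_def)
  ultimately show ?thesis using S by (intro exI[of _ A]) (auto simp: A_def)
qed

lemma sat_heavy_fibre:
  assumes "r < d" "k \<le> n" "0 < n"
  shows "sat n (heavy_fibre d k r) d = k * n ^ r"
proof -
  have card_ones: "card (ones A) = k * n ^ r"
    if "is_matrix01 d A" "dims A = replicate d n" "saturated (heavy_fibre d k r) A" for A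
    using that assms saturated_heavy_fibre_iff[of d A n r k] card_ones_eq_sum_fibre[of d A n r]
    by (simp add: card_positions_replicate)
  obtain B where "is_matrix01 d B" "dims B = replicate d n" "saturated (heavy_fibre d k r) B"
    using exists_constant_fibres[OF assms] saturated_heavy_fibre_iff assms by metis
  \<comment> \<open>All saturated matrices have equally many 1-entries, so the infimum is over a
    singleton.\<close>
  then have "{card (ones A) |A. is_matrix01 d A \<and> dims A = replicate d n \<and>
      saturated (heavy_fibre d k r) A} = {k * n ^ r}"
    using card_ones by force
  then show ?thesis by (simp add: sat_def)
qed

theorem theorem4p8:
  fixes d k r :: nat
  assumes "d \<ge> 1" and "k \<ge> 1" and "r \<le> d - 1"
  shows "\<exists>\<P>. (\<forall>P\<in>\<P>. is_matrix01 d P) \<and>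
           (\<forall>\<^sub>F n in sequentially. sat n \<P> d = k * n ^ r)"
proof (intro exI conjI)
  show "\<forall>P\<in>heavy_fibre d k r. is_matrix01 d P" by (simp add: heavy_fibre_def)
  show "\<forall>\<^sub>F n in sequentially. sat n (heavy_fibre d k r) d = k * n ^ r"
    \<comment> \<open>From \<open>k \<le> n\<close> and \<open>k \<ge> 1\<close> follows
      \<open>0 < n\<close>; \<open>d \<ge> 1\<close> turns \<open>r \<le> d - 1\<close> into
      \<open>r < d\<close> despite truncated subtraction.\<close>
    using eventually_ge_at_top[of k] by eventually_elim (use assms sat_heavy_fibre in auto)
qed

end
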